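(* Let $\mathcal{O}\subseteq\mathbb{N}$ be a set of non-negative integers which is closed under taking divisors and contains $0$. Then there exist a finitely generated torsion-free group $G$ and a finitely generated subgroup $H\leqslant G$ such that $\mathrm{Ord}_H(G)=\mathcal{O}$.
   Context: $\mathbb{N}$ contains $0$. Convention: no natural number divides $0$ (so "closed under taking divisors" imposes no condition coming from $0$). For a group $G$, a subset $S\subseteq G$ and $g\in G$, the (relative) order of $g$ in $S$ is $\mathrm{Ord}_S(g)=\min\{k\geq 1: g^k\in S\}$ if such $k$ exists, and $\mathrm{Ord}_S(g)=0$ otherwise. The spectrum of $G$ with respect to $S$ is $\mathrm{Ord}_S(G)=\{\mathrm{Ord}_S(g): g\in G\}$.
   Formalization: The set O is additionally assumed to be different from {0}: the identity always has relative order 1, so {0}, which is closed under divisors by the stated convention, is never a spectrum and the claim fails for it. *)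

theory Defs
  imports "HOL-Algebra.Algebra"
begin

definition rel_ord :: "('a, 'b) monoid_scheme \<Rightarrow> 'a set \<Rightarrow> 'a \<Rightarrow> nat" where
  "rel_ord G S g =
     (if \<exists>k::nat. k \<ge> 1 \<and> g [^]\<^bsub>G\<^esub> k \<in> S
      then (LEAST k::nat. k \<ge> 1 \<and> g [^]\<^bsub>G\<^esub> k \<in> S) else 0)"

definition rel_spectrum :: "('a, 'b) monoid_scheme \<Rightarrow> 'a set \<Rightarrow> nat set" where
  "rel_spectrum G S = rel_ord G S ` carrier G"

definition torsion_free :: "('a, 'b) monoid_scheme \<Rightarrow> bool" where
  "torsion_free G \<longleftrightarrow>
     (\<forall>g \<in> carrier G. \<forall>n::nat. n \<ge> 1 \<and> g [^]\<^bsub>G\<^esub> n = \<one>\<^bsub>G\<^esub> \<longrightarrow> g = \<one>\<^bsub>G\<^esub>)"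

definition fin_gen_group :: "('a, 'b) monoid_scheme \<Rightarrow> bool" where
  "fin_gen_group G \<longleftrightarrow>
     group G \<and> (\<exists>A. finite A \<and> A \<subseteq> carrier G \<and> generate G A = carrier G)"

definition fin_gen_subgroup :: "'a set \<Rightarrow> ('a, 'b) monoid_scheme \<Rightarrow> bool" where
  "fin_gen_subgroup H G \<longleftrightarrow>
     subgroup H G \<and> (\<exists>A. finite A \<and> A \<subseteq> H \<and> generate G A = H)"

(* closed under taking divisors, with the convention that no natural number divides 0 *)
definition divisor_closed :: "nat set \<Rightarrow> bool" where
  "divisor_closed S \<longleftrightarrow> (\<forall>n \<in> S. \<forall>d. n \<noteq> 0 \<and> d dvd n \<longrightarrow> d \<in> S)"

end

theory Submission
  imports Defs "HOL-Library.Countable_Set"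
begin

text \<open>The amalgam \<open>Y\<close> of infinite cyclic groups \<open>\<langle>y\<^sub>n\<rangle>\<close>, for nonzero \<open>n\<close> in the given set, along
  \<open>y\<^sub>n\<^sup>n = c\<close> is countable and torsion-free, and \<open>Y / \<langle>c\<rangle>\<close> is a free product of cyclic groups of
  order \<open>n\<close>; so the orders relative to \<open>\<langle>c\<rangle>\<close> are the divisors of the \<open>n\<close>, and possibly 0.
  B. H. Neumann's construction embeds \<open>Y\<close> as a coordinate subgroup of a finitely generated subgroup
  of the iterated unrestricted wreath product of \<open>Y\<close> with the integers. As \<open>Y\<close> is torsion-free, so is
  the wreath product, and an element with a positive power in the coordinate subgroup lies in it.
  Hence the embedding creates no order relative to \<open>\<langle>c\<rangle>\<close> except 0.\<close>

section \<open>Relative orders\<close>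

lemma rel_ord_consistent: "rel_ord (G\<lparr>carrier := K\<rparr>) S g = rel_ord G S g"
  by (auto simp: rel_ord_def nat_pow_def)

lemma rel_ord_eq_0:
  assumes "\<And>k::nat. k \<ge> 1 \<Longrightarrow> g [^]\<^bsub>G\<^esub> k \<notin> S"
  shows "rel_ord G S g = 0"
  using assms by (auto simp: rel_ord_def)

lemma (in group) subgroup_nat_pow_closed:
  assumes "subgroup S G" "g \<in> S"
  shows "g [^] (n::nat) \<in> S"
  using assms by (induction n) (auto simp: subgroup.one_closed subgroup.m_closed)

text \<open>Division with remainder by the least exponent \<open>d\<close>: the power with exponent
  \<open>n mod d\<close> again lies in \<open>S\<close>, so minimality makes the remainder 0. One
  positive exponent from a divisor-closed set thus places the order in that set.\<close>

lemma (in group) rel_ord_dvd: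
  fixes n :: nat
  assumes S: "subgroup S G" and g: "g \<in> carrier G" and n: "n \<ge> 1" "g [^] n \<in> S"
  shows "rel_ord G S g dvd n"
proof -
  let ?P = "\<lambda>k::nat. k \<ge> 1 \<and> g [^] k \<in> S"
  define d where "d = (LEAST k. ?P k)"
  have ex: "\<exists>k. ?P k" using n by blast
  then have d: "?P d" unfolding d_def by (rule LeastI_ex)
  have rd: "rel_ord G S g = d" using ex by (simp add: rel_ord_def d_def)
  have "g [^] n = (g [^] d) [^] (n div d) \<otimes> g [^] (n mod d)"
    using g by (simp add: nat_pow_pow nat_pow_mult)
  then have "g [^] (n mod d) = inv ((g [^] d) [^] (n div d)) \<otimes> g [^] n"
    using g by (simp add: inv_solve_left)
  moreover have "(g [^] d) [^] (n div d) \<in> S"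
    using d S by (simp add: subgroup_nat_pow_closed)
  ultimately have "g [^] (n mod d) \<in> S"
    using n S by (simp add: subgroup.m_closed subgroup.m_inv_closed)
  moreover have "n mod d < d" using d by simp
  ultimately have "n mod d = 0"
    using not_less_Least[of "n mod d" ?P] by (force simp: d_def)
  then show ?thesis using rd by auto
qed

lemma rel_ord_hom_image:
  assumes G: "group G" and K: "group K" and h: "h \<in> hom G K" "inj_on h (carrier G)"
    and S: "S \<subseteq> carrier G" and g: "g \<in> carrier G"
  shows "rel_ord K (h ` S) (h g) = rel_ord G S g"
proof -
  have "h g [^]\<^bsub>K\<^esub> k \<in> h ` S \<longleftrightarrow> g [^]\<^bsub>G\<^esub> k \<in> S" for k :: nat
  proof -
    have "h g [^]\<^bsub>K\<^esub> k = h (g [^]\<^bsub>G\<^esub> k)"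
      using group_hom.hom_nat_pow[of G K h g k] G K h g
      by (simp add: group_hom_def group_hom_axioms_def)
    then show ?thesis
      using inj_on_image_mem_iff[OF h(2) _ S, of "g [^]\<^bsub>G\<^esub> k"] G g
      by (simp add: group.is_monoid monoid.nat_pow_closed)
  qed
  then show ?thesis by (auto simp: rel_ord_def)
qed

text \<open>This is root-closure. Outside an isolated \<open>S\<close> no positive power meets a
  subset of \<open>S\<close>, so elements added there contribute only the relative order 0.\<close>

definition isolated_in :: "('a, 'b) monoid_scheme \<Rightarrow> 'a set \<Rightarrow> bool" where
  "isolated_in G S \<longleftrightarrow> (\<forall>g \<in> carrier G. \<forall>n::nat. n \<ge> 1 \<and> g [^]\<^bsub>G\<^esub> n \<in> S \<longrightarrow> g \<in> S)"

lemma rel_ord_isolated: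
  assumes "isolated_in G S" "T \<subseteq> S" "g \<in> carrier G" "g \<notin> S"
  shows "rel_ord G T g = 0"
  using assms by (intro rel_ord_eq_0) (auto simp: isolated_in_def)

text \<open>A root of an element of the image of \<open>S\<close> first falls into the image of
  \<open>G\<close>; injectivity then pulls the power equation back to \<open>G\<close>. This chains
  the two coordinate embeddings.\<close>

lemma isolated_in_trans:
  assumes G: "group G" and K: "group K" and h: "h \<in> hom G K" "inj_on h (carrier G)"
    and S: "isolated_in G S" "S \<subseteq> carrier G" and i: "isolated_in K (h ` carrier G)"
  shows "isolated_in K (h ` S)"
  unfolding isolated_in_def
proof (intro ballI allI impI)
  fix g and n :: nat
  assume g: "g \<in> carrier K" and n: "1 \<le> n \<and> g [^]\<^bsub>K\<^esub> n \<in> h ` S"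
  then have "g \<in> h ` carrier G" using i S(2) unfolding isolated_in_def by blast
  then obtain x where x: "x \<in> carrier G" "g = h x" by blast
  have "g [^]\<^bsub>K\<^esub> n = h (x [^]\<^bsub>G\<^esub> n)"
    using group_hom.hom_nat_pow[of G K h x n] G K h x
    by (simp add: group_hom_def group_hom_axioms_def)
  then have "x [^]\<^bsub>G\<^esub> n \<in> S"
    using n inj_on_image_mem_iff[OF h(2) _ S(2), of "x [^]\<^bsub>G\<^esub> n"] G x
    by (simp add: group.is_monoid monoid.nat_pow_closed)
  then show "g \<in> h ` S" using S(1) n x unfolding isolated_in_def by blast
qed

section \<open>Torsion-free groups and countably generated subgroups\<close>

lemma torsion_free_consistent:
  assumes "torsion_free G" "K \<subseteq> carrier G"
  shows "torsion_free (G\<lparr>carrier := K\<rparr>)"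
  using assms by (auto simp: torsion_free_def nat_pow_def)

lemma torsion_free_iso:
  assumes G: "group G" and K: "group K" and h: "h \<in> iso G K" and tf: "torsion_free G"
  shows "torsion_free K"
  unfolding torsion_free_def
proof (intro ballI allI impI)
  interpret group_hom G K h
    using assms by (simp add: group_hom_def group_hom_axioms_def iso_def)
  have inj: "inj_on h (carrier G)" and im: "h ` carrier G = carrier K"
    using h by (auto simp: iso_def bij_betw_def)
  fix g and n :: nat
  assume g: "g \<in> carrier K" and n: "1 \<le> n \<and> g [^]\<^bsub>K\<^esub> n = \<one>\<^bsub>K\<^esub>"
  obtain x where x: "x \<in> carrier G" "g = h x" using g im by blast
  have "h (x [^]\<^bsub>G\<^esub> n) = h \<one>\<^bsub>G\<^esub>" using n x by (simp add: hom_nat_pow)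
  then have "x [^]\<^bsub>G\<^esub> n = \<one>\<^bsub>G\<^esub>" using inj x by (metis G.nat_pow_closed G.one_closed inj_onD)
  then show "g = \<one>\<^bsub>K\<^esub>" using tf n x by (auto simp: torsion_free_def)
qed

text \<open>Every element is the product of a finite list over \<open>A\<close> and its inverses,
  and such lists are countably many. This lets the final group be copied onto natural
  numbers.\<close>

lemma (in group) countable_generate:
  assumes A: "countable A" "A \<subseteq> carrier G"
  shows "countable (generate G A)"
proof -
  let ?B = "A \<union> m_inv G ` A"
  let ?p = "\<lambda>xs. foldr (\<otimes>) xs \<one>"
  have B: "?B \<subseteq> carrier G" using A by auto
  have cl: "?p xs \<in> carrier G" if "xs \<in> lists ?B" for xs
    using that B by (induction xs) auto
  have app: "?p (xs @ ys) = ?p xs \<otimes> ?p ys" if "xs \<in> lists ?B" "ys \<in> lists ?B" for xs ys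
    using that(1)
  proof (induction xs)
    case Nil
    then show ?case using cl[OF that(2)] by simp
  next
    case (Cons x xs)
    then have "x \<in> carrier G" using B by auto
    then show ?case using Cons cl[OF that(2)] cl[of xs] by (auto simp: m_assoc)
  qed
  have "generate G A \<subseteq> ?p ` lists ?B"
  proof
    fix x assume "x \<in> generate G A"
    then show "x \<in> ?p ` lists ?B"
    proof induction
      case one
      show ?case by (rule image_eqI[of _ _ "[]"]) auto
    next
      case (incl h)
      then show ?case using A by (intro image_eqI[of _ _ "[h]"]) auto
    next
      case (inv h)
      then show ?case using A by (intro image_eqI[of _ _ "[inv h]"]) auto
    next
      case (eng h1 h2)
      then obtain xs ys where "xs \<in> lists ?B" "h1 = ?p xs" "ys \<in> lists ?B" "h2 = ?p ys" by blast
      then show ?case by (intro image_eqI[of _ _ "xs @ ys"]) (auto simp: app simp del: foldr_append)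
    qed
  qed
  moreover have "countable (lists ?B)" using A by simp
  ultimately show ?thesis by (meson countable_image countable_subset)
qed

section \<open>The unrestricted wreath product with the integers\<close>

text \<open>The integers act by translating functions, so the second factor is read at
  \<open>i - k\<close>. No finiteness is asked of the support, since the step functions used below
  have infinite support in general.\<close>

definition wreath_int :: "('a, 'b) monoid_scheme \<Rightarrow> ((int \<Rightarrow> 'a) \<times> int) monoid" where
  "wreath_int G = \<lparr>carrier = {(f, k). \<forall>i. f i \<in> carrier G},
     monoid.mult = (\<lambda>(f, k) (g, l). (\<lambda>i. f i \<otimes>\<^bsub>G\<^esub> g (i - k), k + l)),
     one = (\<lambda>_. \<one>\<^bsub>G\<^esub>, 0)\<rparr>"

definition coord0 :: "('a, 'b) monoid_scheme \<Rightarrow> 'a \<Rightarrow> (int \<Rightarrow> 'a) \<times> int" where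
  "coord0 G y = (\<lambda>i. if i = 0 then y else \<one>\<^bsub>G\<^esub>, 0)"

lemma wreath_int_mem: "(f, k) \<in> carrier (wreath_int G) \<longleftrightarrow> (\<forall>i. f i \<in> carrier G)"
  by (simp add: wreath_int_def)

lemma wreath_int_mult:
  "(f, k) \<otimes>\<^bsub>wreath_int G\<^esub> (g, l) = (\<lambda>i. f i \<otimes>\<^bsub>G\<^esub> g (i - k), k + l)"
  by (simp add: wreath_int_def)

lemma wreath_int_one: "\<one>\<^bsub>wreath_int G\<^esub> = (\<lambda>_. \<one>\<^bsub>G\<^esub>, 0)"
  by (simp add: wreath_int_def)

lemma group_wreath_int:
  assumes "group G"
  shows "group (wreath_int G)"
proof -
  interpret group G by fact
  show ?thesis
  proof (rule groupI)
    fix x assume "x \<in> carrier (wreath_int G)"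
    then obtain f k where x: "x = (f, k)" "\<And>i. f i \<in> carrier G" by (cases x) (auto simp: wreath_int_mem)
    then show "\<exists>y\<in>carrier (wreath_int G). y \<otimes>\<^bsub>wreath_int G\<^esub> x = \<one>\<^bsub>wreath_int G\<^esub>"
      by (intro bexI[of _ "(\<lambda>i. inv\<^bsub>G\<^esub> f (i + k), - k)"])
        (auto simp: wreath_int_mem wreath_int_mult wreath_int_one)
  qed (auto simp: wreath_int_mem wreath_int_mult wreath_int_one m_assoc diff_diff_eq)
qed

lemma wreath_int_inv:
  assumes "group G" "\<And>i. f i \<in> carrier G"
  shows "inv\<^bsub>wreath_int G\<^esub> (f, k) = (\<lambda>i. inv\<^bsub>G\<^esub> f (i + k), - k)"
proof -
  interpret group G by fact
  show ?thesis
    using assms(2)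
    by (intro group.inv_equality[OF group_wreath_int[OF assms(1)]])
      (auto simp: wreath_int_mem wreath_int_mult wreath_int_one)
qed

lemma wreath_int_pow_snd: "snd (x [^]\<^bsub>wreath_int G\<^esub> (n::nat)) = int n * snd x"
proof (induction n)
  case (Suc n)
  then show ?case
    by (cases "x [^]\<^bsub>wreath_int G\<^esub> n", cases x) (simp add: nat_pow_def wreath_int_mult algebra_simps)
qed (simp add: nat_pow_def wreath_int_one)

lemma wreath_int_pow_base: "(f, 0) [^]\<^bsub>wreath_int G\<^esub> (n::nat) = (\<lambda>i. f i [^]\<^bsub>G\<^esub> n, 0)"
  by (induction n) (simp_all add: nat_pow_def wreath_int_mult wreath_int_one)

text \<open>The integer part of a torsion element vanishes because the power multiplies it by
  \<open>n\<close>; what is left is a function, whose powers are pointwise.\<close>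

lemma torsion_free_wreath_int:
  assumes "torsion_free G"
  shows "torsion_free (wreath_int G)"
  unfolding torsion_free_def
proof (intro ballI allI impI)
  fix x and n :: nat
  assume x: "x \<in> carrier (wreath_int G)" and n: "1 \<le> n \<and> x [^]\<^bsub>wreath_int G\<^esub> n = \<one>\<^bsub>wreath_int G\<^esub>"
  have "snd x = 0" using wreath_int_pow_snd[of G x n] n by (simp add: wreath_int_one)
  then obtain f where f: "x = (f, 0)" by (metis prod.collapse)
  have "f i [^]\<^bsub>G\<^esub> n = \<one>\<^bsub>G\<^esub>" for i
    using n f wreath_int_pow_base[of G f n] by (simp add: wreath_int_one fun_eq_iff)
  then have "f i = \<one>\<^bsub>G\<^esub>" for i
    using assms n x f by (auto simp: torsion_free_def wreath_int_mem)
  then show "x = \<one>\<^bsub>wreath_int G\<^esub>" using f by (auto simp: wreath_int_one)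
qed

lemma coord0_hom:
  assumes "group G"
  shows "coord0 G \<in> hom G (wreath_int G)" "inj_on (coord0 G) A"
proof -
  interpret group G by fact
  show "coord0 G \<in> hom G (wreath_int G)"
    by (auto simp: hom_def coord0_def wreath_int_mem wreath_int_mult)
  show "inj_on (coord0 G) A"
    by (rule inj_onI) (simp add: coord0_def fun_eq_iff split: if_splits)
qed

text \<open>Torsion-freeness is what isolates a coordinate: the other coordinates of an element whose
  power lies in it are torsion.\<close>

lemma isolated_coord0:
  assumes G: "group G" and tf: "torsion_free G"
  shows "isolated_in (wreath_int G) (coord0 G ` carrier G)"
  unfolding isolated_in_def
proof (intro ballI allI impI)
  fix x and n :: nat
  assume x: "x \<in> carrier (wreath_int G)"
    and n: "1 \<le> n \<and> x [^]\<^bsub>wreath_int G\<^esub> n \<in> coord0 G ` carrier G"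
  then obtain y where y: "x [^]\<^bsub>wreath_int G\<^esub> n = coord0 G y" by blast
  have "snd x = 0" using wreath_int_pow_snd[of G x n] n y by (simp add: coord0_def)
  then obtain f where f: "x = (f, 0)" by (metis prod.collapse)
  have "f i [^]\<^bsub>G\<^esub> n = \<one>\<^bsub>G\<^esub>" if "i \<noteq> 0" for i
    using that y f wreath_int_pow_base[of G f n] by (simp add: coord0_def fun_eq_iff)
  then have "f i = \<one>\<^bsub>G\<^esub>" if "i \<noteq> 0" for i
    using that tf n x f by (auto simp: torsion_free_def wreath_int_mem)
  then have "x = coord0 G (f 0)" using f by (auto simp: coord0_def)
  moreover have "f 0 \<in> carrier G" using x f by (simp add: wreath_int_mem)
  ultimately show "x \<in> coord0 G ` carrier G" by blast
qed

text \<open>Conjugation by a power of the shift brings coordinate \<open>k\<close> to position 0,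
  where a commutator can single it out.\<close>

lemma wreath_int_shift:
  assumes "group G" "\<And>i. f i \<in> carrier G"
  shows "inv\<^bsub>wreath_int G\<^esub> (\<lambda>_. \<one>\<^bsub>G\<^esub>, k) \<otimes>\<^bsub>wreath_int G\<^esub> (f, 0) \<otimes>\<^bsub>wreath_int G\<^esub> (\<lambda>_. \<one>\<^bsub>G\<^esub>, k)
    = (\<lambda>i. f (i + k), 0)"
proof -
  interpret group G by fact
  show ?thesis
    using assms(2) by (simp add: wreath_int_inv[OF assms(1)] wreath_int_mult)
qed

lemma wreath_int_commutator:
  assumes "group G" "\<And>i. f i \<in> carrier G" "\<And>i. g i \<in> carrier G"
  shows "(f, 0) \<otimes>\<^bsub>wreath_int G\<^esub> (g, 0) \<otimes>\<^bsub>wreath_int G\<^esub> inv\<^bsub>wreath_int G\<^esub> (f, 0)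
      \<otimes>\<^bsub>wreath_int G\<^esub> inv\<^bsub>wreath_int G\<^esub> (g, 0)
    = (\<lambda>i. f i \<otimes>\<^bsub>G\<^esub> g i \<otimes>\<^bsub>G\<^esub> inv\<^bsub>G\<^esub> f i \<otimes>\<^bsub>G\<^esub> inv\<^bsub>G\<^esub> g i, 0)"
  using assms(2,3) by (simp add: wreath_int_inv[OF assms(1)] wreath_int_mult)

lemma wreath_int_pow_shift:
  assumes "group G"
  shows "(\<lambda>_. \<one>\<^bsub>G\<^esub>, 1) [^]\<^bsub>wreath_int G\<^esub> (n::nat) = (\<lambda>_. \<one>\<^bsub>G\<^esub>, int n)"
proof -
  interpret group G by fact
  show ?thesis by (induction n) (simp_all add: nat_pow_def wreath_int_mult wreath_int_one)
qed

text \<open>Conjugating by the shift moves the step by one place. The commutator is therefore a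
  quotient of neighbouring values of \<open>f\<close>, which agree except at 0, where
  \<open>y\<close> remains.\<close>

lemma commutator_step_shift:
  fixes G (structure)
  assumes "group G" "y \<in> carrier G"
  defines "f \<equiv> (\<lambda>i::int. if i \<ge> 0 then y else \<one>)" and "s \<equiv> (\<lambda>_::int. \<one>, 1::int)"
  shows "(f, 0) \<otimes>\<^bsub>wreath_int G\<^esub> s \<otimes>\<^bsub>wreath_int G\<^esub> inv\<^bsub>wreath_int G\<^esub> (f, 0)
      \<otimes>\<^bsub>wreath_int G\<^esub> inv\<^bsub>wreath_int G\<^esub> s = coord0 G y"
proof -
  interpret group G by fact
  have f: "f i \<in> carrier G" for i using assms(2) by (simp add: f_def)
  have "f i \<otimes> inv f (i - 1) = (if i = 0 then y else \<one>)" for i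
    using assms(2) by (auto simp: f_def)
  then have "f i \<otimes> inv f (i - 1) \<otimes> \<one> = (if i = 0 then y else \<one>)" for i
    using assms(2) by simp
  then show ?thesis
    using f by (simp add: s_def wreath_int_inv[OF assms(1)] wreath_int_mult coord0_def)
      (rule ext, use assms(2) in simp)
qed

text \<open>In the wreath product every \<open>y\<close> becomes the commutator of its step function with the
  shift; in the iterated one, shifting a sequence \<open>a\<close> of such step functions against the shift
  \<open>b\<close> placed at coordinate 0 cuts out one of these commutators at a time.\<close>

lemma sequence_in_finitely_generated:
  fixes y :: "nat \<Rightarrow> 'a"
  assumes G: "group G" and y: "\<And>n. y n \<in> carrier G"
  defines "V \<equiv> wreath_int G"
  defines "W \<equiv> wreath_int V"
  shows "\<exists>A. finite A \<and> A \<subseteq> carrier W \<and> (\<forall>n. coord0 V (coord0 G (y n)) \<in> generate W A)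
           \<and> (\<exists>t\<in>A. snd t \<noteq> 0)"
proof -
  interpret G: group G by fact
  interpret V: group V unfolding V_def by (rule group_wreath_int[OF G])
  interpret W: group W unfolding W_def by (rule group_wreath_int[OF V.is_group])
  define st :: "nat \<Rightarrow> int \<Rightarrow> 'a" where "st n = (\<lambda>i. if i \<ge> 0 then y n else \<one>\<^bsub>G\<^esub>)" for n
  define s :: "(int \<Rightarrow> 'a) \<times> int" where "s = (\<lambda>_. \<one>\<^bsub>G\<^esub>, 1)"
  \<comment> \<open>For negative \<open>i\<close>, \<open>nat\<close> gives 0, so these coordinates
    repeat \<open>st 0\<close>. The filler is harmless: \<open>b\<close> is nontrivial only at 0,
    and position 0 of the shift of \<open>a\<close> by \<open>n\<close> holds
    \<open>st n\<close>.\<close>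
  define f :: "int \<Rightarrow> (int \<Rightarrow> 'a) \<times> int" where "f i = (st (nat i), 0)" for i
  define g :: "int \<Rightarrow> (int \<Rightarrow> 'a) \<times> int" where "g i = (if i = 0 then s else \<one>\<^bsub>V\<^esub>)" for i
  define a where "a = (f, 0::int)"
  define b where "b = (g, 0::int)"
  define t where "t = ((\<lambda>_. \<one>\<^bsub>V\<^esub>) :: int \<Rightarrow> (int \<Rightarrow> 'a) \<times> int, 1::int)"
  have sV: "s \<in> carrier V" by (simp add: V_def s_def wreath_int_mem)
  have f: "f i \<in> carrier V" for i using y by (simp add: f_def V_def st_def wreath_int_mem)
  have g: "g i \<in> carrier V" for i using sV by (simp add: g_def)
  have A: "{a, b, t} \<subseteq> carrier W"
    using f g by (simp add: W_def wreath_int_mem a_def b_def t_def)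
  define S where "S = generate W {a, b, t}"
  have S: "subgroup S W" unfolding S_def by (rule W.generate_is_subgroup[OF A])
  have mem: "a \<in> S" "b \<in> S" "t \<in> S" unfolding S_def by (auto intro: generate.incl)
  have cl: "u \<otimes>\<^bsub>W\<^esub> v \<in> S" "inv\<^bsub>W\<^esub> v \<in> S" if "u \<in> S" "v \<in> S" for u v
    using S that by (simp_all add: subgroup.m_closed subgroup.m_inv_closed)
  have "coord0 V (coord0 G (y n)) \<in> S" for n
  proof -
    define T where "T = ((\<lambda>_. \<one>\<^bsub>V\<^esub>) :: int \<Rightarrow> (int \<Rightarrow> 'a) \<times> int, int n)"
    have "T = t [^]\<^bsub>W\<^esub> n"
      unfolding T_def t_def W_def by (rule wreath_int_pow_shift[OF V.is_group, symmetric])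
    then have TS: "T \<in> S" using W.subgroup_nat_pow_closed[OF S mem(3)] by simp
    define x where "x = inv\<^bsub>W\<^esub> T \<otimes>\<^bsub>W\<^esub> a \<otimes>\<^bsub>W\<^esub> T"
    have xS: "x \<in> S" unfolding x_def using cl TS mem by simp
    define f' where "f' = (\<lambda>i. f (i + int n))"
    have f': "f' i \<in> carrier V" for i using f by (simp add: f'_def)
    have x: "x = (f', 0)"
      unfolding x_def T_def a_def W_def f'_def by (rule wreath_int_shift[OF V.is_group f])
    have pt: "f' i \<otimes>\<^bsub>V\<^esub> g i \<otimes>\<^bsub>V\<^esub> inv\<^bsub>V\<^esub> f' i \<otimes>\<^bsub>V\<^esub> inv\<^bsub>V\<^esub> g i
        = (if i = 0 then coord0 G (y n) else \<one>\<^bsub>V\<^esub>)" for i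
    proof (cases "i = 0")
      case True
      then have "f' i = (st n, 0)" "g i = s" by (simp_all add: f'_def f_def g_def)
      then show ?thesis
        using commutator_step_shift[OF G y, of n] True
        unfolding V_def s_def st_def by simp
    next
      case False
      then show ?thesis using f'[of i] by (simp add: g_def)
    qed
    have "x \<otimes>\<^bsub>W\<^esub> b \<otimes>\<^bsub>W\<^esub> inv\<^bsub>W\<^esub> x \<otimes>\<^bsub>W\<^esub> inv\<^bsub>W\<^esub> b
        = (\<lambda>i. f' i \<otimes>\<^bsub>V\<^esub> g i \<otimes>\<^bsub>V\<^esub> inv\<^bsub>V\<^esub> f' i \<otimes>\<^bsub>V\<^esub> inv\<^bsub>V\<^esub> g i, 0)"
      unfolding x b_def W_def by (rule wreath_int_commutator[OF V.is_group f' g])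
    also have "\<dots> = coord0 V (coord0 G (y n))" by (simp only: pt coord0_def[of V])
    finally have "coord0 V (coord0 G (y n)) = x \<otimes>\<^bsub>W\<^esub> b \<otimes>\<^bsub>W\<^esub> inv\<^bsub>W\<^esub> x \<otimes>\<^bsub>W\<^esub> inv\<^bsub>W\<^esub> b"
      by (rule sym)
    then show ?thesis using cl xS mem by simp
  qed
  moreover have "snd t \<noteq> 0" by (simp add: t_def)
  ultimately show ?thesis
    using A unfolding S_def by (intro exI[of _ "{a, b, t}"] conjI bexI[of _ t]) simp_all
qed

text \<open>Injectivity keeps the relative orders of \<open>Y\<close>, isolation gives every other
  element order 0, and a generator with nonzero integer part ensures that 0 occurs.\<close>

lemma fin_gen_embedding:
  fixes Y :: "'a monoid" and y :: "nat \<Rightarrow> 'a"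
  assumes Y: "group Y" and tf: "torsion_free Y"
    and y: "\<And>n. y n \<in> carrier Y" "generate Y (range y) = carrier Y"
    and B: "finite B" "B \<subseteq> carrier Y"
  shows "\<exists>(G :: nat monoid) H. fin_gen_group G \<and> torsion_free G \<and> fin_gen_subgroup H G
           \<and> rel_spectrum G H = insert 0 (rel_spectrum Y (generate Y B))"
proof -
  interpret Y: group Y by fact
  let ?V = "wreath_int Y"
  define W where "W = wreath_int ?V"
  interpret V: group ?V by (rule group_wreath_int[OF Y])
  interpret W: group W unfolding W_def by (rule group_wreath_int[OF V.is_group])
  define h where "h = coord0 ?V \<circ> coord0 Y"
  have hW: "h \<in> hom Y W"
    unfolding h_def W_def using coord0_hom(1)[OF Y] coord0_hom(1)[OF V.is_group] by (rule hom_compose)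
  have inj: "inj_on h S" for S
    unfolding h_def using coord0_hom(2)[OF Y] coord0_hom(2)[OF V.is_group] by (intro comp_inj_on) auto
  have iso: "isolated_in W (h ` carrier Y)"
  proof -
    have "isolated_in W (coord0 ?V ` coord0 Y ` carrier Y)"
    proof (rule isolated_in_trans[OF V.is_group W.is_group])
      show "coord0 ?V \<in> hom ?V W" "inj_on (coord0 ?V) (carrier ?V)"
        unfolding W_def by (fact coord0_hom[OF V.is_group])+
      show "isolated_in ?V (coord0 Y ` carrier Y)" by (rule isolated_coord0[OF Y tf])
      show "coord0 Y ` carrier Y \<subseteq> carrier ?V" using coord0_hom(1)[OF Y] by (rule hom_carrier)
      show "isolated_in W (coord0 ?V ` carrier ?V)"
        unfolding W_def by (rule isolated_coord0[OF V.is_group torsion_free_wreath_int[OF tf]])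
    qed
    then show ?thesis by (simp add: h_def image_comp)
  qed
  obtain A t where A: "finite A" "A \<subseteq> carrier W" "\<And>n. h (y n) \<in> generate W A" "t \<in> A" "snd t \<noteq> 0"
    using sequence_in_finitely_generated[OF Y, of y] y(1) unfolding W_def h_def by auto
  define M where "M = W\<lparr>carrier := generate W A\<rparr>"
  have sub: "subgroup (generate W A) W" by (rule W.generate_is_subgroup[OF A(2)])
  interpret M: group M unfolding M_def by (rule subgroup.subgroup_is_group[OF sub W.is_group])
  have AM: "A \<subseteq> carrier M" by (auto simp: M_def intro: generate.incl)
  have genM: "generate M A = carrier M"
    unfolding M_def using W.generate_consistent[OF _ sub, of A] by (auto intro: generate.incl)
  have MW: "carrier M \<subseteq> carrier W" unfolding M_def using sub by (simp add: subgroup.subset)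
  have im: "h ` carrier Y \<subseteq> carrier M"
  proof -
    interpret h: group_hom Y W h using hW by unfold_locales
    have "h ` carrier Y = generate W (h ` range y)"
      using h.generate_img[of "range y"] y by auto
    also have "\<dots> \<subseteq> generate W A"
      using A(3) by (intro W.generate_subgroup_incl[OF _ sub]) auto
    finally show ?thesis by (simp add: M_def)
  qed
  \<comment> \<open>The generated subgroup is countable although \<open>W\<close> is not; an
    enumeration copies it onto natural numbers.\<close>
  define e where "e = to_nat_on (carrier M)"
  have cM: "countable (carrier M)"
    using W.countable_generate[OF _ A(2)] A(1) by (simp add: M_def countable_finite)
  have inje: "inj_on e (carrier M)" unfolding e_def using cM by (rule inj_on_to_nat_on)
  define K where "K = image_group e M"
  have K: "group K" unfolding K_def by (rule M.inj_imp_image_group_is_group[OF inje])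
  interpret K: group K by (rule K)
  have eiso: "e \<in> iso M K" unfolding K_def by (rule inj_imp_image_group_iso[OF inje])
  have ehom: "e \<in> hom M K" and eim: "e ` carrier M = carrier K"
    using eiso by (auto simp: iso_def bij_betw_def)
  have hM: "h \<in> hom Y M" using hW im by (auto simp: hom_def M_def)
  have "e \<circ> h \<in> hom Y K" using hM ehom by (rule hom_compose)
  then interpret eh: group_hom Y K "e \<circ> h" by unfold_locales
  interpret e: group_hom M K e using ehom by unfold_locales
  define C where "C = generate Y B"
  have C: "C \<subseteq> carrier Y" unfolding C_def by (rule Y.generate_incl[OF B(2)])
  let ?H = "e ` h ` C"
  have genH: "generate K ((e \<circ> h) ` B) = ?H"
    using eh.generate_img[OF B(2)] by (simp add: C_def image_comp)
  have "fin_gen_group K"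
    unfolding fin_gen_group_def
  proof (intro conjI exI)
    show "generate K (e ` A) = carrier K" using e.generate_img[OF AM] genM eim by simp
  qed (use A(1) AM eim K in auto)
  moreover have "torsion_free K"
  proof -
    have "torsion_free W" unfolding W_def by (intro torsion_free_wreath_int tf)
    then have "torsion_free M" using MW unfolding M_def by (intro torsion_free_consistent) simp_all
    then show ?thesis by (rule torsion_free_iso[OF M.is_group K eiso])
  qed
  moreover have "fin_gen_subgroup ?H K"
    unfolding fin_gen_subgroup_def
  proof (intro conjI exI)
    have eB: "(e \<circ> h) ` B \<subseteq> carrier K" using B(2) eh.hom_closed by blast
    show "subgroup ?H K" using K.generate_is_subgroup[OF eB] genH by simp
    show "generate K ((e \<circ> h) ` B) = ?H" by (rule genH)
    show "(e \<circ> h) ` B \<subseteq> ?H" by (simp only: genH[symmetric] subsetI generate.incl)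
  qed (use B(1) in auto)
  moreover have "rel_spectrum K ?H = insert 0 (rel_spectrum Y C)"
  proof -
    have hC: "h ` C \<subseteq> carrier M" using C im by blast
    have ord: "rel_ord K ?H (e g) = rel_ord W (h ` C) g" if "g \<in> carrier M" for g
      using rel_ord_hom_image[OF M.is_group K ehom inje hC that]
      by (simp add: M_def rel_ord_consistent)
    have ordY: "rel_ord W (h ` C) (h g) = rel_ord Y C g" if "g \<in> carrier Y" for g
      by (rule rel_ord_hom_image[OF Y W.is_group hW inj C that])
    have ord0: "rel_ord W (h ` C) g = 0" if "g \<in> carrier M" "g \<notin> h ` carrier Y" for g
      using that C MW by (intro rel_ord_isolated[OF iso]) auto
    \<comment> \<open>Elements of the embedded \<open>Y\<close> have integer part 0, so the
      generator \<open>t\<close> lies outside and realises the order 0.\<close>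
    have t: "t \<in> carrier M" "t \<notin> h ` carrier Y"
      using A(4,5) AM by (auto simp: h_def coord0_def)
    have "rel_spectrum K ?H = rel_ord K ?H ` (e ` carrier M)"
      unfolding rel_spectrum_def eim ..
    also have "\<dots> = (rel_ord K ?H \<circ> e) ` carrier M" by (rule image_comp)
    also have "\<dots> = rel_ord W (h ` C) ` carrier M"
      by (rule image_cong) (simp_all only: comp_apply ord)
    also have "\<dots> = insert 0 (rel_ord Y C ` carrier Y)"
    proof (intro equalityI subsetI)
      fix n assume "n \<in> rel_ord W (h ` C) ` carrier M"
      then obtain g where g: "g \<in> carrier M" "n = rel_ord W (h ` C) g" by blast
      show "n \<in> insert 0 (rel_ord Y C ` carrier Y)"
      proof (cases "g \<in> h ` carrier Y")
        case True
        then obtain x where "x \<in> carrier Y" "g = h x" by blast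
        then show ?thesis using g(2) ordY by simp
      next
        case False
        then show ?thesis using g ord0 by simp
      qed
    next
      fix n assume "n \<in> insert 0 (rel_ord Y C ` carrier Y)"
      then consider "n = 0" | x where "x \<in> carrier Y" "n = rel_ord Y C x" by blast
      then show "n \<in> rel_ord W (h ` C) ` carrier M"
      proof cases
        case 1
        then show ?thesis using ord0[OF t] t(1) by (intro image_eqI[of _ _ t]) simp_all
      next
        case (2 x)
        then show ?thesis using ordY[of x] im by (intro image_eqI[of _ _ "h x"]) auto
      qed
    qed
    also have "\<dots> = insert 0 (rel_spectrum Y C)" by (simp only: rel_spectrum_def)
    finally show ?thesis .
  qed
  ultimately show ?thesis unfolding C_def by blast
qed

section \<open>Roots of a central element\<close>

lemma funpow_intertwine: "f \<circ> u = u \<circ> g \<Longrightarrow> (f ^^ k) \<circ> u = u \<circ> (g ^^ k)"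
  by (induction k) (auto simp: fun_eq_iff)

lemma funpow_comp_commute:
  assumes "f \<circ> g = g \<circ> f"
  shows "(f \<circ> g) ^^ k = (f ^^ k) \<circ> (g ^^ k)"
proof (induction k)
  case (Suc k)
  have "(f \<circ> g) ^^ Suc k = f \<circ> (g \<circ> (f ^^ k)) \<circ> (g ^^ k)"
    by (simp only: funpow.simps Suc comp_assoc)
  also have "g \<circ> (f ^^ k) = (f ^^ k) \<circ> g" using funpow_intertwine[OF assms] by simp
  finally show ?case by (simp add: comp_assoc)
qed simp

text \<open>A word lists the letters of a product, \<open>(n, a)\<close> standing for \<open>y\<^sub>n\<^sup>a\<close>; paired with \<open>k\<close> it
  represents that product times \<open>c\<^sup>k\<close>. The maps \<open>root_perm n\<close> and \<open>central_shift 1\<close> are left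
  multiplication by \<open>y\<^sub>n\<close> (for \<open>n \<ge> 2\<close>) and by \<open>c\<close>; non-reduced words are junk and are left fixed.\<close>

definition reduced :: "(nat \<times> nat) list \<Rightarrow> bool" where
  "reduced w \<longleftrightarrow> (\<forall>(n, a) \<in> set w. 0 < a \<and> a < n) \<and> distinct_adj (map fst w)"

definition central_shift :: "int \<Rightarrow> (nat \<times> nat) list \<times> int \<Rightarrow> (nat \<times> nat) list \<times> int" where
  "central_shift m = (\<lambda>(w, k). if reduced w then (w, k + m) else (w, k))"

definition root_perm :: "nat \<Rightarrow> (nat \<times> nat) list \<times> int \<Rightarrow> (nat \<times> nat) list \<times> int" where
  "root_perm n = (\<lambda>(w, k). if \<not> reduced w then (w, k) else
     case w of [] \<Rightarrow> ([(n, 1)], k)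
     | (m, a) # v \<Rightarrow> if m \<noteq> n then ((n, 1) # w, k)
         else if a + 1 < n then ((n, a + 1) # v, k) else (v, k + 1))"

fun word_perm :: "(nat \<times> nat) list \<Rightarrow> (nat \<times> nat) list \<times> int \<Rightarrow> (nat \<times> nat) list \<times> int" where
  "word_perm [] = id"
| "word_perm ((n, a) # w) = (root_perm n ^^ a) \<circ> word_perm w"

section \<open>Action of the roots and of the central element on normal forms\<close>

lemma reduced_Nil [simp]: "reduced []"
  by (simp add: reduced_def)

lemma reduced_Cons:
  "reduced ((n, a) # w) \<longleftrightarrow> 0 < a \<and> a < n \<and> (w = [] \<or> fst (hd w) \<noteq> n) \<and> reduced w"
  by (cases w) (auto simp: reduced_def)

lemma reduced_append:
  "reduced (v @ w) \<longleftrightarrow> reduced v \<and> reduced w \<and> (v = [] \<or> w = [] \<or> fst (last v) \<noteq> fst (hd w))"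
  by (auto simp: reduced_def distinct_adj_append_iff last_map hd_map)

lemma central_apply: "reduced w \<Longrightarrow> central_shift m (w, k) = (w, k + m)"
  by (simp add: central_shift_def)

lemma central_comp: "central_shift m \<circ> central_shift l = central_shift (m + l)"
  by (auto simp: central_shift_def fun_eq_iff)

lemma central_0: "central_shift 0 = id"
  by (auto simp: central_shift_def fun_eq_iff)

lemma central_inject: "central_shift m = central_shift l \<longleftrightarrow> m = l"
  by (metis add_left_cancel central_apply prod.inject reduced_Nil)

lemma bij_central: "bij (central_shift m)"
  by (rule o_bij[of "central_shift (- m)"]) (simp_all add: central_comp central_0)

lemma central_pow: "central_shift m ^^ k = central_shift (int k * m)"
  by (induction k) (simp_all add: central_0 central_comp algebra_simps)

lemma root_perm_not_reduced: "\<not> reduced w \<Longrightarrow> root_perm n (w, k) = (w, k)"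
  by (simp add: root_perm_def)

lemma root_perm_new:
  "reduced v \<Longrightarrow> v = [] \<or> fst (hd v) \<noteq> n \<Longrightarrow> root_perm n (v, k) = ((n, 1) # v, k)"
  by (cases v) (auto simp: root_perm_def)

lemma root_perm_same:
  "reduced ((n, a) # v) \<Longrightarrow>
    root_perm n ((n, a) # v, k) = (if a + 1 < n then ((n, a + 1) # v, k) else (v, k + 1))"
  by (simp add: root_perm_def)

text \<open>Expresses that \<open>c\<close> is central. For \<open>n < 2\<close> the letter
  \<open>(n, 1)\<close> is not reduced, and \<open>root_perm n\<close> would turn the empty word
  into a junk word that \<open>central_shift\<close> fixes, whence the bound here and below.\<close>

lemma central_root:
  assumes "n \<ge> 2"
  shows "central_shift m \<circ> root_perm n = root_perm n \<circ> central_shift m"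
proof -
  have "central_shift m (root_perm n (w, k)) = root_perm n (central_shift m (w, k))" for w k
  proof (cases "reduced w")
    case False
    then show ?thesis by (simp add: root_perm_not_reduced central_shift_def)
  next
    case True
    show ?thesis
    proof (cases "w = [] \<or> fst (hd w) \<noteq> n")
      case new: True
      then have "reduced ((n, 1) # w)" using True assms by (simp add: reduced_Cons)
      then show ?thesis by (simp only: central_apply[OF True] root_perm_new[OF True new] central_apply)
    next
      case False
      then obtain a v where w: "w = (n, a) # v" by (cases w) auto
      then have "reduced v" "a + 1 < n \<Longrightarrow> reduced ((n, a + 1) # v)"
        using True by (auto simp: reduced_Cons)
      then show ?thesis
        using root_perm_same[OF True[unfolded w]] True by (simp add: w central_apply)
    qed
  qed
  then show ?thesis by (simp add: fun_eq_iff)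
qed

lemma root_push:
  assumes "reduced v" "v = [] \<or> fst (hd v) \<noteq> n" "0 < a" "a < n"
  shows "(root_perm n ^^ a) (v, k) = ((n, a) # v, k)"
  using assms(3,4)
proof (induction a)
  case (Suc a)
  show ?case
  proof (cases "a = 0")
    case True
    then show ?thesis using root_perm_new[OF assms(1,2)] by simp
  next
    case False
    then have "reduced ((n, a) # v)" using assms(1,2) Suc by (simp add: reduced_Cons)
    then show ?thesis using Suc False by (simp add: root_perm_same)
  qed
qed simp

text \<open>On a reduced word not beginning with \<open>n\<close>, the first \<open>n - 1\<close>
  steps build a letter and the last one deletes it, carrying 1 into the integer. Any other reduced
  word arises from such a word by a power of the same map, which commutes with the
  \<open>n\<close>-th power. This is the defining relation of the amalgam.\<close>

lemma root_pow_self: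
  assumes n: "n \<ge> 2"
  shows "root_perm n ^^ n = central_shift 1"
proof -
  have top: "(root_perm n ^^ n) (v, k) = (v, k + 1)" if "reduced v" "v = [] \<or> fst (hd v) \<noteq> n" for v k
  proof -
    have "(root_perm n ^^ Suc (n - 1)) (v, k) = root_perm n ((n, n - 1) # v, k)"
      using root_push[OF that, of "n - 1" k] n by (simp only: funpow.simps comp_apply)
    also have "\<dots> = (v, k + 1)" using n that by (simp add: root_perm_same reduced_Cons)
    finally show ?thesis using n by simp
  qed
  have "(root_perm n ^^ n) (w, k) = central_shift 1 (w, k)" for w k
  proof (cases "reduced w")
    case False
    have "(root_perm n ^^ a) (w, k) = (w, k)" for a
      using False by (induction a) (simp_all add: root_perm_not_reduced)
    then show ?thesis using False by (simp add: central_shift_def)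
  next
    case True
    show ?thesis
    proof (cases "w = [] \<or> fst (hd w) \<noteq> n")
      case True
      then show ?thesis using \<open>reduced w\<close> by (simp add: top central_apply)
    next
      case False
      then obtain a v where w: "w = (n, a) # v" by (cases w) auto
      have v: "reduced v" "v = [] \<or> fst (hd v) \<noteq> n" "0 < a" "a < n"
        using \<open>reduced w\<close> by (auto simp: w reduced_Cons)
      have "(root_perm n ^^ n) (w, k) = (root_perm n ^^ n) ((root_perm n ^^ a) (v, k))"
        by (simp add: w root_push[OF v])
      also have "\<dots> = (root_perm n ^^ a) ((root_perm n ^^ n) (v, k))"
        by (metis add.commute comp_apply funpow_add)
      also have "\<dots> = (w, k + 1)" using v by (simp add: top root_push w)
      finally show ?thesis using \<open>reduced w\<close> by (simp add: central_apply)
    qed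
  qed
  then show ?thesis by (simp add: fun_eq_iff)
qed

lemma bij_root:
  assumes "n \<ge> 2"
  shows "bij (root_perm n)"
proof -
  have n: "n = Suc (n - 1)" using assms by simp
  have "root_perm n ^^ n = root_perm n \<circ> (root_perm n ^^ (n - 1))" "root_perm n ^^ n = (root_perm n ^^ (n - 1)) \<circ> root_perm n"
    by (subst n, simp only: funpow.simps diff_Suc_1, subst n, simp only: funpow_Suc_right diff_Suc_1)
  then show ?thesis
    using bij_central[of 1] unfolding root_pow_self[OF assms]
    by (metis bij_def inj_on_imageI2 surj_def comp_apply bij_betw_def inj_on_def)
qed

lemma central_root_pow:
  assumes "n \<ge> 2"
  shows "central_shift m \<circ> (root_perm n ^^ a) = (root_perm n ^^ a) \<circ> central_shift m"
  using funpow_intertwine[OF central_root[OF assms, of m, symmetric]] by simp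

lemma root_pow_add_self:
  assumes "n \<ge> 2"
  shows "root_perm n ^^ (n + a) = central_shift 1 \<circ> (root_perm n ^^ a)"
  by (simp add: funpow_add root_pow_self[OF assms])

lemma word_perm_append: "word_perm (v @ w) = word_perm v \<circ> word_perm w"
  by (induction v rule: word_perm.induct) (auto simp: comp_assoc)

text \<open>With \<open>v\<close> empty, the image of the empty word spells out \<open>w\<close>;
  this is what separates distinct normal forms.\<close>

lemma word_perm_apply:
  "reduced (w @ v) \<Longrightarrow> word_perm w (v, k) = (w @ v, k)"
  by (induction w rule: word_perm.induct) (auto simp: reduced_Cons root_push)

lemma central_word_perm:
  assumes "reduced w"
  shows "central_shift m \<circ> word_perm w = word_perm w \<circ> central_shift m"
  using assms
proof (induction w rule: word_perm.induct)
  case (2 n a w)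
  then have "reduced w" and "n \<ge> 2" by (auto simp: reduced_Cons)
  with 2(1) have "central_shift m \<circ> word_perm w = word_perm w \<circ> central_shift m" by blast
  with \<open>n \<ge> 2\<close> show ?case
    using central_root_pow[of n m a] by (simp only: word_perm.simps comp_assoc[symmetric]) (simp only: comp_assoc)
qed simp

section \<open>The permutation group and its normal forms\<close>

definition perm_group :: "('a \<Rightarrow> 'a) monoid" where
  "perm_group = \<lparr>carrier = {f. bij f}, monoid.mult = (\<circ>), one = id\<rparr>"

lemma group_perm_group: "group perm_group"
proof (rule groupI)
  fix f :: "'a \<Rightarrow> 'a" assume "f \<in> carrier perm_group"
  then have "bij f" by (simp add: perm_group_def)
  then show "\<exists>g\<in>carrier perm_group. g \<otimes>\<^bsub>perm_group\<^esub> f = \<one>\<^bsub>perm_group\<^esub>"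
    by (intro bexI[of _ "Hilbert_Choice.inv f"]) (auto simp: perm_group_def bij_imp_bij_inv bij_is_inj)
qed (auto simp: perm_group_def bij_comp comp_assoc)

lemma perm_group_pow: "f [^]\<^bsub>perm_group\<^esub> (n::nat) = f ^^ n"
  by (induction n) (simp_all add: nat_pow_def perm_group_def funpow_Suc_right del: funpow.simps(2))

definition word_perms :: "nat set \<Rightarrow> ((nat \<times> nat) list \<times> int \<Rightarrow> (nat \<times> nat) list \<times> int) set" where
  "word_perms N = {central_shift m \<circ> word_perm w | m w. reduced w \<and> fst ` set w \<subseteq> N}"

lemma central_word_perms:
  assumes "x \<in> word_perms N"
  shows "central_shift m \<circ> x \<in> word_perms N"
proof -
  obtain l w where "x = central_shift l \<circ> word_perm w" "reduced w" "fst ` set w \<subseteq> N"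
    using assms by (auto simp: word_perms_def)
  then show ?thesis
    unfolding word_perms_def
    by (intro CollectI exI[of _ "m + l"] exI[of _ w]) (simp add: central_comp[symmetric] comp_assoc)
qed

text \<open>Multiplying a normal form by a root adds a letter, raises the first exponent or, when
  that exponent reaches \<open>n\<close>, trades the letter for the central element.\<close>

lemma root_word_perms:
  assumes n: "n \<in> N" "n \<ge> 2" and x: "x \<in> word_perms N"
  shows "root_perm n \<circ> x \<in> word_perms N"
proof -
  obtain m w where w: "x = central_shift m \<circ> word_perm w" "reduced w" "fst ` set w \<subseteq> N"
    using x by (auto simp: word_perms_def)
  have mem: "central_shift l \<circ> word_perm v \<in> word_perms N" if "reduced v" "fst ` set v \<subseteq> N" for l v
    using that by (auto simp: word_perms_def)
  have eq: "root_perm n \<circ> x = central_shift m \<circ> (root_perm n \<circ> word_perm w)"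
    using central_root[OF n(2), of m] by (simp add: w(1) comp_assoc[symmetric])
  show ?thesis
  proof (cases "w = [] \<or> fst (hd w) \<noteq> n")
    case True
    have "root_perm n \<circ> x = central_shift m \<circ> word_perm ((n, 1) # w)" by (simp add: eq)
    moreover have "reduced ((n, 1) # w)" using True w(2) n(2) by (simp add: reduced_Cons)
    ultimately show ?thesis using mem[of "(n, 1) # w" m] w(3) n(1) by simp
  next
    case False
    then obtain a v where v: "w = (n, a) # v" by (cases w) auto
    have eq: "root_perm n \<circ> x = central_shift m \<circ> ((root_perm n ^^ Suc a) \<circ> word_perm v)"
      unfolding eq v by (simp add: comp_assoc)
    show ?thesis
    proof (cases "Suc a < n")
      case True
      then have "central_shift m \<circ> word_perm ((n, Suc a) # v) \<in> word_perms N"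
        using w n by (intro mem) (auto simp: v reduced_Cons)
      then show ?thesis unfolding eq by (simp only: word_perm.simps)
    next
      case False
      then have "Suc a = n" using w(2) by (auto simp: v reduced_Cons)
      then have "root_perm n \<circ> x = central_shift m \<circ> (central_shift 1 \<circ> word_perm v)"
        using eq root_pow_self[OF n(2)] by simp
      moreover have "central_shift 1 \<circ> word_perm v \<in> word_perms N"
        using w by (intro mem) (auto simp: v reduced_Cons)
      ultimately show ?thesis using central_word_perms by simp
    qed
  qed
qed

text \<open>Indexed by all natural numbers to serve as the sequence fed to
  \<open>fin_gen_embedding\<close>. Indices that name no proper root, always including 0, give the
  central element.\<close>

definition root_gen :: "nat set \<Rightarrow> nat \<Rightarrow> (nat \<times> nat) list \<times> int \<Rightarrow> (nat \<times> nat) list \<times> int" where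
  "root_gen N n = (if n \<in> N \<and> n \<ge> 2 then root_perm n else central_shift 1)"

lemma bij_root_gen: "bij (root_gen N n)"
  by (simp add: root_gen_def bij_root bij_central)

text \<open>Inverses need no separate word calculus: every generator has a power
  \<open>Suc a\<close> equal to \<open>central_shift 1\<close>, so its inverse is its power
  \<open>a\<close> times \<open>central_shift (- 1)\<close>.\<close>

lemma root_gen_word_perms:
  assumes "x \<in> word_perms N"
  shows "root_gen N n \<circ> x \<in> word_perms N" "inv\<^bsub>perm_group\<^esub> (root_gen N n) \<circ> x \<in> word_perms N"
proof -
  let ?y = "root_gen N n"
  have step: "?y \<circ> x \<in> word_perms N" if "x \<in> word_perms N" for x
    using that by (simp add: root_gen_def root_word_perms central_word_perms)
  show "?y \<circ> x \<in> word_perms N" by (rule step[OF assms])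
  interpret group "perm_group :: ((nat \<times> nat) list \<times> int \<Rightarrow> (nat \<times> nat) list \<times> int) monoid"
    by (rule group_perm_group)
  obtain a where a: "?y ^^ Suc a = central_shift 1"
  proof (cases "n \<in> N \<and> n \<ge> 2")
    case True
    then show ?thesis using that[of "n - 1"] root_pow_self[of n] by (simp add: root_gen_def del: funpow.simps)
  next
    case False
    then show ?thesis using that[of 0] by (auto simp: root_gen_def)
  qed
  have "inv\<^bsub>perm_group\<^esub> ?y = central_shift (- 1) \<circ> (?y ^^ a)"
  proof (rule inv_equality)
    have "central_shift (- 1) \<circ> (?y ^^ a) \<circ> ?y = central_shift (- 1) \<circ> (?y ^^ Suc a)"
      by (simp only: funpow_Suc_right comp_assoc)
    also have "\<dots> = id" by (simp only: a central_comp) (simp add: central_0)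
    finally show "(central_shift (- 1) \<circ> (?y ^^ a)) \<otimes>\<^bsub>perm_group\<^esub> ?y = \<one>\<^bsub>perm_group\<^esub>"
      by (simp add: perm_group_def comp_assoc)
  qed (auto simp: perm_group_def bij_root_gen bij_comp bij_central bij_fn)
  moreover have "(?y ^^ a) \<circ> x \<in> word_perms N"
  proof (induction a)
    case (Suc a)
    then show ?case using step[OF Suc] by (simp only: funpow.simps comp_assoc)
  qed (simp add: assms)
  ultimately show "inv\<^bsub>perm_group\<^esub> ?y \<circ> x \<in> word_perms N"
    using central_word_perms by (simp add: comp_assoc)
qed

lemma generate_root_gen: "generate perm_group (range (root_gen N)) \<subseteq> word_perms N"
proof
  fix g assume "g \<in> generate perm_group (range (root_gen N))"
  \<comment> \<open>Strengthened for the induction: left multiplication by \<open>g\<close>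
    preserves normal forms, so a product needs only composition. Applying this to \<open>id\<close>
    returns the membership of \<open>g\<close>.\<close>
  then have "g \<circ> x \<in> word_perms N" if "x \<in> word_perms N" for x
    using that
  proof (induction arbitrary: x)
    case one
    then show ?case by (simp add: perm_group_def)
  next
    case (incl h)
    then show ?case using root_gen_word_perms(1) by blast
  next
    case (inv h)
    then show ?case using root_gen_word_perms(2) by blast
  next
    case (eng h1 h2)
    then show ?case by (simp add: perm_group_def comp_assoc)
  qed
  moreover have "id \<in> word_perms N"
    unfolding word_perms_def by (intro CollectI exI[of _ 0] exI[of _ "[]"]) (simp add: central_0)
  ultimately have "g \<circ> id \<in> word_perms N" by blast
  then show "g \<in> word_perms N" by simp
qed

text \<open>Conjugation fixes every power of the central element. It is written
  \<open>g \<circ> u = u \<circ> g'\<close> to avoid the inverse of \<open>u\<close>.\<close>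

lemma central_pow_conj:
  assumes u: "bij u" "\<And>j. central_shift j \<circ> u = u \<circ> central_shift j" and g: "g \<circ> u = u \<circ> g'"
  shows "g ^^ k = central_shift j \<longleftrightarrow> g' ^^ k = central_shift j"
proof -
  have pow: "(g ^^ k) \<circ> u = u \<circ> (g' ^^ k)"
    by (rule funpow_intertwine[OF g])
  show ?thesis
  proof
    assume "g ^^ k = central_shift j"
    then have "u \<circ> central_shift j = u \<circ> (g' ^^ k)" using pow u(2) by simp
    then show "g' ^^ k = central_shift j" using u(1) by (simp add: bij_def fun_eq_iff inj_eq)
  next
    assume "g' ^^ k = central_shift j"
    then have "(g ^^ k) \<circ> u = central_shift j \<circ> u" using pow u(2) by simp
    then show "g ^^ k = central_shift j" using u(1) by (metis bij_is_surj surj_fun_eq comp_apply fun_eq_iff surj_def)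
  qed
qed

lemma central_comp_pow:
  assumes "central_shift m \<circ> f = f \<circ> central_shift m"
  shows "(central_shift m \<circ> f) ^^ k = central_shift (int k * m) \<circ> (f ^^ k)"
  by (simp add: funpow_comp_commute[OF assms] central_pow)

lemma word_perm_pow: "word_perm w ^^ k = word_perm (concat (replicate k w))"
  by (induction k) (simp_all add: word_perm_append)

text \<open>The end of one copy and the start of the next belong to different roots, so nothing
  merges at the seams.\<close>

lemma reduced_concat_replicate:
  assumes "reduced w" "w \<noteq> []" "fst (last w) \<noteq> fst (hd w)"
  shows "reduced (concat (replicate k w))"
proof (induction k)
  case (Suc k)
  have "concat (replicate k w) = [] \<or> hd (concat (replicate k w)) = hd w"
    using assms(2) by (cases k) auto
  then show ?case using Suc assms by (auto simp: reduced_append)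
qed simp

text \<open>Up to conjugation a normal form has length at most one or is cyclically reduced, and the
  powers of a cyclically reduced one move the empty word.\<close>

lemma word_perms_roots:
  fixes w :: "(nat \<times> nat) list"
  assumes N: "1 \<in> N" and w: "reduced w" "fst ` set w \<subseteq> N" and g: "g = central_shift m \<circ> word_perm w"
  shows "((\<exists>n\<in>N. n \<ge> 1 \<and> (\<exists>j. g ^^ n = central_shift j)) \<or> (\<forall>k\<ge>1. \<forall>j. g ^^ k \<noteq> central_shift j))
         \<and> (\<forall>k\<ge>1. g ^^ k = central_shift 0 \<longrightarrow> g ^^ 1 = central_shift 0)"
  using w g
proof (induction "length w" arbitrary: w m g rule: less_induct)
  case less
  consider "w = []" | n a where "w = [(n, a)]" | n a v l b where "w = (n, a) # v @ [(l, b)]"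
    by (metis append_Nil list.exhaust prod.exhaust rev_exhaust)
  then show ?case
  proof cases
    case 1
    then have "g = central_shift m" by (simp add: less)
    then show ?thesis using N by (auto simp: central_pow central_inject)
  next
    case (2 n a)
    then have n: "n \<ge> 2" "n \<in> N" "0 < a" "a < n" using less by (auto simp: reduced_Cons)
    have g: "g = central_shift m \<circ> (root_perm n ^^ a)" using 2 by (simp add: less)
    have "(root_perm n ^^ a) ^^ n = central_shift (int a)"
      by (metis central_pow funpow_mult mult.commute mult.right_neutral n(1) root_pow_self)
    then have gn: "g ^^ n = central_shift (int n * m + int a)"
      unfolding g central_comp_pow[OF central_root_pow[OF n(1)]] by (simp add: central_comp)
    \<comment> \<open>As \<open>0 < a < n\<close>, this exponent is nonzero modulo \<open>n\<close>;
      so \<open>g ^^ n\<close> is a nontrivial power of the central element, which has infinite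
      order.\<close>
    have nz: "int n * m + int a \<noteq> 0"
    proof
      assume "int n * m + int a = 0"
      then have "int a = int n * (- m)" by simp
      then have "int n dvd int a" by (rule dvdI)
      then show False using n by (auto dest: dvd_imp_le)
    qed
    have "g ^^ k \<noteq> central_shift 0" if "k \<ge> 1" for k
    proof
      assume k: "g ^^ k = central_shift 0"
      have "(g ^^ n) ^^ k = (g ^^ k) ^^ n" by (simp add: funpow_mult mult.commute)
      then have "central_shift (int k * (int n * m + int a)) = central_shift 0"
        unfolding gn k central_pow by simp
      then show False using nz that by (simp add: central_inject)
    qed
    moreover have "\<exists>n\<in>N. n \<ge> 1 \<and> (\<exists>j. g ^^ n = central_shift j)"
      using n gn by (intro bexI[of _ n] conjI exI) auto
    ultimately show ?thesis by blast
  next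
    case (3 n a v l b)
    show ?thesis
    proof (cases "n = l")
      case False
      have "g ^^ k \<noteq> central_shift j" if k: "k \<ge> 1" for k j
      proof
        assume "g ^^ k = central_shift j"
        \<comment> \<open>On the left the empty word becomes the \<open>k\<close>-fold repetition of
          \<open>w\<close>, on the right it stays empty.\<close>
        then have "central_shift (int k * m) (word_perm (concat (replicate k w)) ([], 0)) = central_shift j ([], 0)"
          using less(2,4) central_comp_pow[OF central_word_perm[OF less(2)]]
          by (metis comp_apply word_perm_pow)
        moreover have "reduced (concat (replicate k w))"
          using less(2) 3 False by (intro reduced_concat_replicate) auto
        ultimately show False
          using word_perm_apply[of "concat (replicate k w)" "[]" 0] k 3
          by (cases k) (auto simp: central_apply)
      qed
      then show ?thesis by blast
    next
      case True
      then have n: "n \<ge> 2" "n \<in> N" "0 < a" "a < n" "0 < b" "b < n"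
        and v: "reduced v" "v = [] \<or> fst (last v) \<noteq> n" "fst ` set v \<subseteq> N"
        using less(2,3) 3 by (auto simp: reduced_Cons reduced_append)
      \<comment> \<open>Conjugating by the first letter moves it to the end, where it merges with
        the last letter, a power of the same root. Whether \<open>b + a\<close> stays below, hits or
        exceeds \<open>n\<close>, the word gets shorter.\<close>
      define u where "u = root_perm n ^^ a"
      define g' where "g' = central_shift m \<circ> (word_perm v \<circ> (root_perm n ^^ (b + a)))"
      have u: "bij u" "\<And>j. central_shift j \<circ> u = u \<circ> central_shift j"
        unfolding u_def using n by (simp_all add: bij_fn bij_root central_root_pow)
      have "g = central_shift m \<circ> (u \<circ> (word_perm v \<circ> (root_perm n ^^ b)))"
        using 3 True by (simp add: less word_perm_append u_def)
      then have "g \<circ> u = (central_shift m \<circ> u) \<circ> (word_perm v \<circ> ((root_perm n ^^ b) \<circ> u))"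
        by (simp only: comp_assoc)
      also have "(root_perm n ^^ b) \<circ> u = root_perm n ^^ (b + a)" by (simp only: funpow_add u_def)
      also have "(central_shift m \<circ> u) \<circ> (word_perm v \<circ> (root_perm n ^^ (b + a))) = u \<circ> g'"
        by (simp only: u(2) g'_def comp_assoc)
      finally have "g \<circ> u = u \<circ> g'" .
      then have conj: "g ^^ k = central_shift j \<longleftrightarrow> g' ^^ k = central_shift j" for k j
        by (rule central_pow_conj[OF u])
      have "\<exists>m' w'. length w' < length w \<and> reduced w' \<and> fst ` set w' \<subseteq> N \<and> g' = central_shift m' \<circ> word_perm w'"
      proof -
        consider "b + a < n" | "b + a = n" | "b + a > n" by linarith
        then show ?thesis
        proof cases
          case 1
          then show ?thesis using n v 3
            by (intro exI[of _ m] exI[of _ "v @ [(n, b + a)]"])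
              (auto simp: g'_def word_perm_append reduced_append reduced_Cons)
        next
          case 2
          then have "g' = central_shift (m + 1) \<circ> word_perm v"
            using central_word_perm[OF v(1), of 1]
            by (simp add: g'_def root_pow_self[OF n(1)] central_comp[symmetric] comp_assoc)
          then show ?thesis using v 3 by (intro exI[of _ "m + 1"] exI[of _ v]) auto
        next
          case gt: 3
          then have "root_perm n ^^ (b + a) = central_shift 1 \<circ> (root_perm n ^^ (b + a - n))"
            using root_pow_add_self[OF n(1), of "b + a - n"] by simp
          then have "g' = central_shift m \<circ> ((word_perm v \<circ> central_shift 1) \<circ> (root_perm n ^^ (b + a - n)))"
            by (simp add: g'_def comp_assoc)
          then have "g' = central_shift m \<circ> ((central_shift 1 \<circ> word_perm v) \<circ> (root_perm n ^^ (b + a - n)))"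
            by (simp only: central_word_perm[OF v(1)])
          then have "g' = central_shift (m + 1) \<circ> word_perm (v @ [(n, b + a - n)])"
            by (simp add: word_perm_append central_comp[symmetric] comp_assoc)
          then show ?thesis using gt n v 3
            by (intro exI[of _ "m + 1"] exI[of _ "v @ [(n, b + a - n)]"])
              (auto simp: reduced_append reduced_Cons)
        qed
      qed
      then obtain m' w' where "length w' < length w" "reduced w'" "fst ` set w' \<subseteq> N"
        "g' = central_shift m' \<circ> word_perm w'" by blast
      \<comment> \<open>Both claims involve only equations \<open>g ^^ k = central_shift j\<close>,
        the identity being written \<open>central_shift 0\<close> and \<open>g\<close> itself
        \<open>g ^^ 1\<close>; so \<open>conj\<close> turns the goal into the induction hypothesis
        for \<open>g'\<close>.\<close>
      from less(1)[OF this] show ?thesis unfolding conj .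
    qed
  qed
qed

section \<open>The amalgam and its orders relative to the central subgroup\<close>

lemma generate_central_shift: "generate perm_group {central_shift 1} = range central_shift"
proof -
  interpret group "perm_group :: ((nat \<times> nat) list \<times> int \<Rightarrow> (nat \<times> nat) list \<times> int) monoid"
    by (rule group_perm_group)
  let ?C = "generate perm_group {central_shift 1}"
  have c: "central_shift m \<in> carrier perm_group" for m by (simp add: perm_group_def bij_central)
  have mult: "central_shift m \<otimes>\<^bsub>perm_group\<^esub> central_shift l = central_shift (m + l)" for m l
    by (simp add: perm_group_def central_comp)
  have one: "\<one>\<^bsub>perm_group\<^esub> = central_shift 0" by (simp add: perm_group_def central_0)
  have inv: "inv\<^bsub>perm_group\<^esub> central_shift m = central_shift (- m)" for m
    by (rule inv_equality) (simp_all add: mult one c)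
  have "subgroup (range central_shift) perm_group"
    by (rule subgroupI) (auto simp: c mult inv)
  then have "?C \<subseteq> range central_shift" by (intro generate_subgroup_incl) auto
  moreover have "central_shift m \<in> ?C" for m
  proof (induction m rule: int_induct[where k = 0])
    case base
    show ?case using generate.one[of perm_group "{central_shift 1}"] by (simp add: one)
  next
    case (step1 i)
    have "central_shift i \<otimes>\<^bsub>perm_group\<^esub> central_shift 1 \<in> ?C"
      by (rule generate.eng[OF step1(2) generate.incl]) simp
    then show ?case by (simp add: mult)
  next
    case (step2 i)
    have "central_shift i \<otimes>\<^bsub>perm_group\<^esub> inv\<^bsub>perm_group\<^esub> central_shift 1 \<in> ?C"
      by (rule generate.eng[OF step2(2) generate.inv]) simp
    then show ?case by (simp add: mult inv)
  qed
  ultimately show ?thesis by blast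
qed

text \<open>Van der Waerden's device: as a group of permutations of normal forms, the amalgam gets
  associativity for free.\<close>

definition root_group :: "nat set \<Rightarrow> ((nat \<times> nat) list \<times> int \<Rightarrow> (nat \<times> nat) list \<times> int) monoid" where
  "root_group N = perm_group\<lparr>carrier := generate perm_group (range (root_gen N))\<rparr>"

lemma root_group_carrier: "carrier (root_group N) = generate perm_group (range (root_gen N))"
  by (simp add: root_group_def)

lemma root_group_pow: "f [^]\<^bsub>root_group N\<^esub> (n::nat) = f ^^ n"
  by (simp add: root_group_def monoid.nat_pow_consistent[OF group.is_monoid[OF group_perm_group], symmetric]
      perm_group_pow)

lemma subgroup_root_group: "subgroup (generate perm_group (range (root_gen N))) perm_group"
  by (intro group.generate_is_subgroup[OF group_perm_group]) (auto simp: perm_group_def bij_root_gen)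

lemma group_root_group: "group (root_group N)"
  unfolding root_group_def by (rule subgroup.subgroup_is_group[OF subgroup_root_group group_perm_group])

lemma root_gen_mem: "root_gen N n \<in> carrier (root_group N)"
  by (simp add: root_group_carrier generate.incl)

lemma generate_root_group:
  assumes "A \<subseteq> carrier (root_group N)"
  shows "generate (root_group N) A = generate perm_group A"
  unfolding root_group_def
  using group.generate_consistent[OF group_perm_group _ subgroup_root_group] assms
  by (simp add: root_group_carrier)

lemma central_1_mem: "central_shift 1 \<in> carrier (root_group N)"
  using root_gen_mem[of N 0] by (simp add: root_gen_def)

lemma root_group_roots:
  assumes "1 \<in> N" "g \<in> carrier (root_group N)"
  shows "(\<exists>n\<in>N. n \<ge> 1 \<and> g ^^ n \<in> range central_shift) \<or> (\<forall>k\<ge>1. g ^^ k \<notin> range central_shift)"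
    and "k \<ge> 1 \<Longrightarrow> g ^^ k = id \<Longrightarrow> g = id"
proof -
  have "g \<in> word_perms N" using assms(2) generate_root_gen by (auto simp: root_group_carrier)
  then obtain m w where "reduced w" "fst ` set w \<subseteq> N" "g = central_shift m \<circ> word_perm w"
    by (auto simp: word_perms_def)
  note * = word_perms_roots[OF assms(1) this]
  have range: "x \<in> range central_shift \<longleftrightarrow> (\<exists>j. x = central_shift j)" for x by auto
  show "(\<exists>n\<in>N. n \<ge> 1 \<and> g ^^ n \<in> range central_shift) \<or> (\<forall>k\<ge>1. g ^^ k \<notin> range central_shift)"
    unfolding range using conjunct1[OF *] by simp
  show "g = id" if "k \<ge> 1" "g ^^ k = id"
    using conjunct2[OF *, rule_format, OF that(1)] that(2) by (simp add: central_0)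
qed

lemma torsion_free_root_group: "1 \<in> N \<Longrightarrow> torsion_free (root_group N)"
  unfolding torsion_free_def root_group_pow
  using root_group_roots(2)[of N] by (auto simp: root_group_def perm_group_def)

text \<open>For \<open>0 < k < n\<close> the \<open>k\<close>-th power sends the empty word to a
  single letter, whereas the central subgroup keeps it empty.\<close>

lemma rel_ord_root_perm:
  assumes "n \<in> N" "n \<ge> 2"
  shows "rel_ord (root_group N) (range central_shift) (root_perm n) = n"
proof -
  have not: "root_perm n ^^ k \<notin> range central_shift" if "0 < k" "k < n" for k
  proof
    assume "root_perm n ^^ k \<in> range central_shift"
    then obtain j where "root_perm n ^^ k = central_shift j" by blast
    then have "([(n, k)], 0) = central_shift j ([], 0)"
      using root_push[of "[]" n k 0] that by simp
    then show False by (simp add: central_apply)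
  qed
  have "(LEAST k::nat. k \<ge> 1 \<and> root_perm n ^^ k \<in> range central_shift) = n"
  proof (rule Least_equality)
    show "n \<ge> 1 \<and> root_perm n ^^ n \<in> range central_shift"
      using assms by (simp add: root_pow_self)
    show "n \<le> k" if "k \<ge> 1 \<and> root_perm n ^^ k \<in> range central_shift" for k
      using not[of k] that by (meson not_le less_le_trans zero_less_one)
  qed
  moreover have "\<exists>k::nat. k \<ge> 1 \<and> root_perm n ^^ k \<in> range central_shift"
    using assms by (intro exI[of _ n]) (simp add: root_pow_self)
  ultimately show ?thesis unfolding rel_ord_def root_group_pow by simp
qed

text \<open>Each element has either no positive power in the central subgroup or one with exponent
  in \<open>N\<close>, so divisor closure confines the orders to \<open>N\<close>. Conversely the
  central element has order 1 and each root its index; 0 is inserted because the group may be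
  cyclic, as for \<open>N = {0, 1}\<close>.\<close>

lemma rel_spectrum_root_group:
  assumes N: "divisor_closed N" "0 \<in> N" "1 \<in> N"
  shows "insert 0 (rel_spectrum (root_group N) (range central_shift)) = N"
proof (intro equalityI subsetI)
  let ?Y = "root_group N" and ?C = "range central_shift"
  interpret Y: group ?Y by (rule group_root_group)
  have c1: "{central_shift 1} \<subseteq> carrier ?Y" using central_1_mem by simp
  have C: "subgroup ?C ?Y"
    using Y.generate_is_subgroup[OF c1] generate_root_group[OF c1] generate_central_shift by simp
  fix n
  show "n \<in> N" if "n \<in> insert 0 (rel_spectrum ?Y ?C)"
  proof -
    have "rel_ord ?Y ?C g \<in> N" if g: "g \<in> carrier ?Y" for g
      using root_group_roots(1)[OF N(3) g]
    proof
      assume "\<exists>n\<in>N. n \<ge> 1 \<and> g ^^ n \<in> ?C"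
      then obtain n where n: "n \<in> N" "n \<ge> 1" "g ^^ n \<in> ?C" by blast
      then have "rel_ord ?Y ?C g dvd n"
        by (intro Y.rel_ord_dvd[OF C g]) (simp_all add: root_group_pow)
      then show ?thesis using N(1) n by (auto simp: divisor_closed_def)
    next
      assume "\<forall>k\<ge>1. g ^^ k \<notin> ?C"
      then show ?thesis using N(2) rel_ord_eq_0[of ?Y g ?C] by (simp add: root_group_pow)
    qed
    then show ?thesis using that N(2) by (auto simp: rel_spectrum_def)
  qed
  show "n \<in> insert 0 (rel_spectrum ?Y ?C)" if n: "n \<in> N"
  proof -
    consider "n = 0" | "n = 1" | "n \<ge> 2" by linarith
    then show ?thesis
    proof cases
      case 2
      have "central_shift 1 [^]\<^bsub>?Y\<^esub> (1::nat) \<in> ?C" unfolding root_group_pow by simp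
      then have "rel_ord ?Y ?C (central_shift 1) dvd 1"
        by (intro Y.rel_ord_dvd[OF C central_1_mem]) simp_all
      then have "n = rel_ord ?Y ?C (central_shift 1)" using 2 by simp
      then show ?thesis using central_1_mem by (auto simp: rel_spectrum_def)
    next
      case 3
      have "root_perm n \<in> carrier ?Y" using root_gen_mem[of N n] n 3 by (simp add: root_gen_def)
      then show ?thesis using rel_ord_root_perm[OF n 3] by (force simp: rel_spectrum_def)
    qed simp
  qed
qed

theorem theorem4p3:
  fixes Ord_set :: "nat set"
  assumes "divisor_closed Ord_set"
    and "0 \<in> Ord_set"
    and "Ord_set \<noteq> {0}"
  shows "\<exists>(G :: nat monoid) H. fin_gen_group G \<and> torsion_free G \<and>
           fin_gen_subgroup H G \<and> rel_spectrum G H = Ord_set"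
proof -
  \<comment> \<open>Excluding \<open>{0}\<close> provides the member 1, the order of the identity
    relative to any subgroup; hence \<open>{0}\<close> is no such spectrum.\<close>
  obtain n where "n \<in> Ord_set" "n \<noteq> 0" using assms(2,3) by blast
  then have one: "1 \<in> Ord_set" using assms(1) by (auto simp: divisor_closed_def)
  let ?Y = "root_group Ord_set"
  have c: "{central_shift 1} \<subseteq> carrier ?Y" using central_1_mem by simp
  have "generate ?Y {central_shift 1} = range central_shift"
    using generate_root_group[OF c] generate_central_shift by simp
  moreover have "generate ?Y (range (root_gen Ord_set)) = carrier ?Y"
    using root_gen_mem by (subst generate_root_group) (auto simp: root_group_carrier)
  ultimately show ?thesis
    using fin_gen_embedding[OF group_root_group torsion_free_root_group[OF one] root_gen_mem _ _ c]
      rel_spectrum_root_group[OF assms(1,2) one] by simp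
qed

end
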